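(* Let $\mathcal{H}$ be a real Hilbert space. For every $k=0,1,2,\ldots$, let $T_k\colon\mathcal{H}\to\mathcal{H}$ be nonexpansive and assume that $C\subseteq\bigcap_k\operatorname{Fix}T_k$ is nonempty, closed and convex. Let $\{e_k\}_{k=0}^\infty\subseteq[0,\infty)$ be a given summable sequence of errors and let $\{x^k\}_{k=0}^\infty\subseteq\mathcal{H}$ be an inexact trajectory such that $$\|x^{k+1}-T_kx^k\|\leq e_k$$ holds for every $k=0,1,2,\ldots$. Assume that for all $i=0,1,2,\ldots$ there is an $x_i^\infty\in C$ such that $$T_k\cdots T_ix^i\rightharpoonup x_i^\infty\quad\text{as }k\to\infty.$$ Then there is a point $x^\infty\in C$ such that $x_i^\infty\to x^\infty$ (as $i\to\infty$) and $x^k\rightharpoonup x^\infty$ (as $k\to\infty$). Moreover, $$|\langle y,x^{k+1}-x^\infty\rangle|\leq|\langle y,T_k\cdots T_ix^i-x_i^\infty\rangle|+2\|y\|\sum_{j=i}^\infty e_j$$ holds for all $y\in\mathcal{H}$, all $i=0,1,2,\ldots$ and all $k\geq i$. If, in addition, for all $i=0,1,2,\ldots$, $$T_k\cdots T_ix^i\to x_i^\infty\quad\text{as }k\to\infty,$$ then $x^k\to x^\infty$. Moreover, in this case, $$\|x^{k+1}-x^\infty\|\leq\|T_k\cdots T_ix^i-x_i^\infty\|+2\sum_{j=i}^\infty e_j$$ for all $i=0,1,2,\ldots$ and all $k\geq i$.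
   Context: $\rightharpoonup$ denotes weak convergence and $\to$ denotes norm convergence. An operator $T\colon\mathcal{H}\to\mathcal{H}$ is nonexpansive if $\|Tx-Ty\|\leq\|x-y\|$ for all $x,y\in\mathcal{H}$. $\operatorname{Fix}T$ is the set of fixed points of $T$. *)

theory Defs
  imports "HOL-Analysis.Analysis"
begin

definition nonexpansive :: "('a::real_normed_vector \<Rightarrow> 'a) \<Rightarrow> bool"
  where "nonexpansive T \<longleftrightarrow> (\<forall>x y. norm (T x - T y) \<le> norm (x - y))"

definition Fix :: "('a \<Rightarrow> 'a) \<Rightarrow> 'a set"
  where "Fix T = {x. T x = x}"

text \<open>Convergence in the weak topology, i.e. under every continuous linear functional.\<close>

definition weakly_tendsto :: "('b \<Rightarrow> 'a::real_normed_vector) \<Rightarrow> 'a \<Rightarrow> 'b filter \<Rightarrow> bool"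
  where "weakly_tendsto X l F \<longleftrightarrow>
    (\<forall>f :: 'a \<Rightarrow> real. bounded_linear f \<longrightarrow> ((\<lambda>n. f (X n)) \<longlongrightarrow> f l) F)"

text \<open>The composition \<open>T k \<circ> \<dots> \<circ> T i\<close>, with \<open>T i\<close> applied first; it is the identity for \<open>k < i\<close>.\<close>

definition comp_from_to :: "(nat \<Rightarrow> 'a \<Rightarrow> 'a) \<Rightarrow> nat \<Rightarrow> nat \<Rightarrow> 'a \<Rightarrow> 'a"
  where "comp_from_to T i k = fold T [i..<Suc k]"

lemma comp_from_to_same: "comp_from_to T i i = T i"
  by (simp add: comp_from_to_def)

lemma comp_from_to_Suc: "i \<le> Suc k \<Longrightarrow> comp_from_to T i (Suc k) = T (Suc k) \<circ> comp_from_to T i k"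
  by (simp add: comp_from_to_def)

end

theory Submission
  imports Defs
begin

text \<open>
  Write \<open>S i k = T k \<circ> \<dots> \<circ> T i\<close> and \<open>s i = (\<Sum>j. e (i + j))\<close>. A nonexpansive map does not enlarge
  errors made earlier, so \<open>x\<close> stays within the accumulated error of every exact trajectory:
  \<open>norm (x (Suc k) - S i k (x i)) \<le> s i\<close>. Likewise two exact trajectories, started from \<open>x i\<close>
  and from \<open>x j\<close> with \<open>i \<le> j\<close>, differ by at most \<open>s i\<close> at all times from \<open>j\<close> on. The norm is weakly
  lower semicontinuous, so this bound passes to the weak limits: \<open>norm (xlim j - xlim i) \<le> s i\<close>.
  As \<open>s i\<close> tends to 0, \<open>xlim\<close> is a Cauchy sequence; its limit \<open>xinf\<close> lies in the closed set \<open>C\<close> and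
  satisfies \<open>norm (xlim i - xinf) \<le> s i\<close>.

  Splitting \<open>x (Suc k) - xinf\<close> as
  \<open>(S i k (x i) - xlim i) + (x (Suc k) - S i k (x i)) + (xlim i - xinf)\<close> then gives both asserted
  inequalities, and convergence follows by choosing first \<open>i\<close> and then \<open>k\<close> large. The weak and the
  strong case differ only in how the size of a vector is measured: by \<open>\<bar>f v\<bar>\<close> for a bounded
  functional \<open>f\<close>, or by \<open>norm v\<close>. Both are subadditive and dominated by a multiple of the norm,
  and the splitting argument is carried out for an arbitrary such gauge \<open>p\<close>.
\<close>

section \<open>Weak convergence\<close>

lemma weakly_tendsto_diff:
  fixes l m :: "'a::real_normed_vector"
  assumes "weakly_tendsto X l F" "weakly_tendsto Y m F"
  shows "weakly_tendsto (\<lambda>n. X n - Y n) (l - m) F"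
  unfolding weakly_tendsto_def
proof (intro allI impI)
  fix f :: "'a \<Rightarrow> real"
  assume f: "bounded_linear f"
  then have "((\<lambda>n. f (X n) - f (Y n)) \<longlongrightarrow> f l - f m) F"
    using assms by (intro tendsto_diff) (auto simp: weakly_tendsto_def)
  then show "((\<lambda>n. f (X n - Y n)) \<longlongrightarrow> f (l - m)) F"
    using f by (simp add: bounded_linear.linear linear_diff)
qed

text \<open>Weak lower semicontinuity of the norm, in the form that closed balls are weakly closed.\<close>

lemma weakly_tendsto_norm_le:
  fixes l :: "'a::real_inner"
  assumes "weakly_tendsto X l F" and F: "F \<noteq> bot" and le: "\<forall>\<^sub>F n in F. norm (X n) \<le> B"
  shows "norm l \<le> B"
proof -
  have "((\<lambda>n. l \<bullet> X n) \<longlongrightarrow> l \<bullet> l) F"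
    using assms(1) bounded_linear_inner_right unfolding weakly_tendsto_def by blast
  moreover have "\<forall>\<^sub>F n in F. l \<bullet> X n \<le> norm l * B"
    using le
  proof eventually_elim
    case (elim n)
    have "l \<bullet> X n \<le> norm l * norm (X n)" by (rule norm_cauchy_schwarz)
    also have "\<dots> \<le> norm l * B" using elim by (simp add: mult_left_mono)
    finally show ?case .
  qed
  ultimately have "l \<bullet> l \<le> norm l * B"
    using F by (rule tendsto_upperbound)
  then have "norm l * norm l \<le> norm l * B"
    by (simp add: dot_square_norm power2_eq_square)
  moreover have "0 \<le> B"
  proof -
    obtain n where "norm (X n) \<le> B"
      using eventually_happens'[OF F le] by blast
    then show ?thesis using norm_ge_zero order_trans by blast
  qed
  ultimately show ?thesis
    by (cases "l = 0") simp_all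
qed

section \<open>Tails of the error series\<close>

lemma summable_tail_tendsto_0:
  fixes e :: "nat \<Rightarrow> real"
  assumes "summable e"
  shows "(\<lambda>i. \<Sum>j. e (i + j)) \<longlonglongrightarrow> 0"
proof -
  have "(\<lambda>i. suminf e - sum e {..<i}) \<longlonglongrightarrow> suminf e - suminf e"
    using summable_LIMSEQ[OF assms] by (intro tendsto_intros)
  moreover have "(\<Sum>j. e (i + j)) = suminf e - sum e {..<i}" for i
    using suminf_minus_initial_segment[OF assms, of i] by (simp add: add.commute)
  ultimately show ?thesis by simp
qed

lemma sum_le_summable_tail:
  fixes e :: "nat \<Rightarrow> real"
  assumes "\<And>k. 0 \<le> e k" "summable e"
  shows "sum e {i..<m} \<le> (\<Sum>j. e (i + j))"
proof -
  have "sum e {i..<m} = (\<Sum>j<m - i. e (i + j))"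
    by (rule sum.reindex_bij_witness[of _ "\<lambda>j. i + j" "\<lambda>j. j - i"]) auto
  also have "\<dots> \<le> (\<Sum>j. e (i + j))"
    using assms summable_iff_shift[of e i] by (intro sum_le_suminf) (auto simp: add.commute)
  finally show ?thesis .
qed

section \<open>Error propagation under nonexpansive maps\<close>

lemma nonexpansive_fold:
  assumes "\<And>k. nonexpansive (T k)"
  shows "nonexpansive (fold T ks)"
proof (induction ks)
  case Nil
  show ?case by (simp add: nonexpansive_def)
next
  case (Cons k ks)
  then show ?case
    using assms[of k] unfolding nonexpansive_def by (simp, meson order_trans)
qed

lemma inexact_trajectory_error:
  fixes T :: "nat \<Rightarrow> 'a \<Rightarrow> 'a::real_normed_vector"
  assumes "\<And>k. nonexpansive (T k)"
    and "\<And>k. norm (x (Suc k) - T k (x k)) \<le> e k"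
    and "i \<le> m"
  shows "norm (x m - fold T [i..<m] (x i)) \<le> sum e {i..<m}"
  using \<open>i \<le> m\<close>
proof (induction m rule: dec_induct)
  case base
  show ?case by simp
next
  case (step m)
  let ?z = "fold T [i..<m] (x i)"
  have "norm (x (Suc m) - T m ?z) \<le> norm (x (Suc m) - T m (x m)) + norm (T m (x m) - T m ?z)"
    using norm_triangle_ineq[of "x (Suc m) - T m (x m)" "T m (x m) - T m ?z"] by simp
  also have "\<dots> \<le> e m + norm (x m - ?z)"
    using assms(1)[of m] assms(2)[of m] unfolding nonexpansive_def by (intro add_mono) auto
  also have "\<dots> \<le> sum e {i..<Suc m}"
    using step by simp
  finally show ?case
    using step by simp
qed

text \<open>The exact trajectory from \<open>x i\<close> is, from time \<open>j\<close> on, an exact trajectory started at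
  \<open>fold T [i..<j] (x i)\<close>; this point and \<open>x j\<close> differ by the errors made before \<open>j\<close>, and the maps
  applied afterwards do not increase that distance.\<close>

lemma restarted_trajectory_error:
  fixes T :: "nat \<Rightarrow> 'a \<Rightarrow> 'a::real_normed_vector"
  assumes "\<And>k. nonexpansive (T k)"
    and "\<And>k. norm (x (Suc k) - T k (x k)) \<le> e k"
    and "i \<le> j" "j \<le> Suc k"
  shows "norm (comp_from_to T j k (x j) - comp_from_to T i k (x i)) \<le> sum e {i..<j}"
proof -
  have "[i..<Suc k] = [i..<j] @ [j..<Suc k]"
    using assms(3,4) by (metis le_Suc_ex upt_add_eq_append)
  then have "comp_from_to T i k (x i) = comp_from_to T j k (fold T [i..<j] (x i))"
    unfolding comp_from_to_def by simp
  then have "norm (comp_from_to T j k (x j) - comp_from_to T i k (x i))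
      \<le> norm (x j - fold T [i..<j] (x i))"
    using nonexpansive_fold[of T, OF assms(1)] unfolding comp_from_to_def nonexpansive_def by simp
  also have "\<dots> \<le> sum e {i..<j}"
    using assms by (intro inexact_trajectory_error)
  finally show ?thesis .
qed

section \<open>Convergence of inexact trajectories\<close>

text \<open>The limits of the exact trajectories started from \<open>x i\<close> converge in norm, at the rate of the
  tails of the error series.\<close>

lemma weak_limits_converge:
  fixes T :: "nat \<Rightarrow> 'a \<Rightarrow> 'a::{real_inner, complete_space}"
  assumes "\<And>k. nonexpansive (T k)"
    and e: "\<And>k. 0 \<le> e k" "summable e"
    and "\<And>k. norm (x (Suc k) - T k (x k)) \<le> e k"
    and lim: "\<And>i. weakly_tendsto (\<lambda>k. comp_from_to T i k (x i)) (xlim i) sequentially"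
  obtains xinf where "xlim \<longlonglongrightarrow> xinf" "\<And>i. norm (xlim i - xinf) \<le> (\<Sum>j. e (i + j))"
proof -
  have bound: "norm (xlim j - xlim i) \<le> (\<Sum>l. e (i + l))" if "i \<le> j" for i j
  proof (rule weakly_tendsto_norm_le[OF weakly_tendsto_diff[OF lim lim]])
    show "\<forall>\<^sub>F k in sequentially.
        norm (comp_from_to T j k (x j) - comp_from_to T i k (x i)) \<le> (\<Sum>l. e (i + l))"
      using eventually_ge_at_top[of j]
    proof eventually_elim
      case (elim k)
      then show ?case
        using restarted_trajectory_error[of T x e i j k] assms(1,4) that
          sum_le_summable_tail[OF e, of i j] by force
    qed
  qed simp
  have "Cauchy xlim"
  proof (rule metric_CauchyI)
    fix r :: real
    assume "0 < r"
    then have "\<forall>\<^sub>F i in sequentially. (\<Sum>l. e (i + l)) < r / 2"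
      using order_tendstoD(2)[OF summable_tail_tendsto_0[OF e(2)], of "r / 2"] by simp
    then obtain N where N: "(\<Sum>l. e (N + l)) < r / 2"
      using eventually_happens by force
    have "dist (xlim m) (xlim n) < r" if "N \<le> m" "N \<le> n" for m n
      using dist_triangle_half_l[of "xlim m" "xlim N" r "xlim n"]
        bound[OF that(1)] bound[OF that(2)] N by (simp add: dist_norm)
    then show "\<exists>M. \<forall>m\<ge>M. \<forall>n\<ge>M. dist (xlim m) (xlim n) < r"
      by blast
  qed
  then obtain xinf where xinf: "xlim \<longlonglongrightarrow> xinf"
    using Cauchy_convergent convergent_def by blast
  have "norm (xlim i - xinf) \<le> (\<Sum>j. e (i + j))" for i
  proof (rule tendsto_upperbound)
    show "(\<lambda>j. norm (xlim i - xlim j)) \<longlonglongrightarrow> norm (xlim i - xinf)"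
      by (intro tendsto_intros xinf)
    show "\<forall>\<^sub>F j in sequentially. norm (xlim i - xlim j) \<le> (\<Sum>j. e (i + j))"
      using eventually_ge_at_top[of i]
      by eventually_elim (simp add: bound norm_minus_commute)
  qed simp
  with xinf show ?thesis using that by blast
qed

text \<open>The splitting argument for a gauge \<open>p\<close>, where \<open>c i\<close> stands for the limit of the exact
  trajectory started from \<open>x i\<close>.\<close>

lemma gauge_estimate:
  fixes T :: "nat \<Rightarrow> 'a \<Rightarrow> 'a::real_normed_vector" and p :: "'a \<Rightarrow> real"
  assumes "\<And>k. nonexpansive (T k)"
    and e: "\<And>k. 0 \<le> e k" "summable e"
    and "\<And>k. norm (x (Suc k) - T k (x k)) \<le> e k"
    and c: "\<And>i. norm (c i - l) \<le> (\<Sum>j. e (i + j))"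
    and subadd: "\<And>u v. p (u + v) \<le> p u + p v"
    and "0 \<le> K" and le: "\<And>v. p v \<le> K * norm v"
    and "i \<le> k"
  shows "p (x (Suc k) - l) \<le> p (comp_from_to T i k (x i) - c i) + 2 * K * (\<Sum>j. e (i + j))"
proof -
  let ?z = "comp_from_to T i k (x i)" and ?s = "\<Sum>j. e (i + j)"
  have "norm (x (Suc k) - ?z) \<le> sum e {i..<Suc k}"
    unfolding comp_from_to_def using assms(1,4) \<open>i \<le> k\<close> by (intro inexact_trajectory_error) auto
  also have "\<dots> \<le> ?s"
    by (rule sum_le_summable_tail[OF e])
  finally have 1: "p (x (Suc k) - ?z) \<le> K * ?s"
    using le \<open>0 \<le> K\<close> by (meson mult_left_mono order_trans)
  have 2: "p (c i - l) \<le> K * ?s"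
    using le c \<open>0 \<le> K\<close> by (meson mult_left_mono order_trans)
  have "p (x (Suc k) - l) \<le> p (?z - c i) + p ((x (Suc k) - ?z) + (c i - l))"
    using subadd[of "?z - c i" "(x (Suc k) - ?z) + (c i - l)"] by simp
  also have "\<dots> \<le> p (?z - c i) + (p (x (Suc k) - ?z) + p (c i - l))"
    by (intro add_left_mono subadd)
  finally show ?thesis
    using 1 2 by simp
qed

lemma gauge_tendsto_0:
  fixes T :: "nat \<Rightarrow> 'a \<Rightarrow> 'a::real_normed_vector" and p :: "'a \<Rightarrow> real"
  assumes "\<And>k. nonexpansive (T k)"
    and e: "\<And>k. 0 \<le> e k" "summable e"
    and "\<And>k. norm (x (Suc k) - T k (x k)) \<le> e k"
    and "\<And>i. norm (c i - l) \<le> (\<Sum>j. e (i + j))"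
    and "\<And>u v. p (u + v) \<le> p u + p v"
    and "0 \<le> K" and "\<And>v. p v \<le> K * norm v" and nonneg: "\<And>v. 0 \<le> p v"
    and lim: "\<And>i. (\<lambda>k. p (comp_from_to T i k (x i) - c i)) \<longlonglongrightarrow> 0"
  shows "(\<lambda>k. p (x k - l)) \<longlonglongrightarrow> 0"
proof -
  have "(\<lambda>k. p (x (Suc k) - l)) \<longlonglongrightarrow> 0"
  proof (rule order_tendstoI)
    show "\<forall>\<^sub>F k in sequentially. a < p (x (Suc k) - l)" if "a < 0" for a
      using that nonneg by (auto intro: always_eventually less_le_trans)
  next
    fix r :: real
    assume "0 < r"
    have "(\<lambda>i. 2 * K * (\<Sum>j. e (i + j))) \<longlonglongrightarrow> 0"
      using tendsto_mult_right_zero[OF summable_tail_tendsto_0[OF e(2)], of "2 * K"] by simp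
    then have "\<forall>\<^sub>F i in sequentially. 2 * K * (\<Sum>j. e (i + j)) < r / 2"
      by (rule order_tendstoD) (use \<open>0 < r\<close> in simp)
    then obtain i where i: "2 * K * (\<Sum>j. e (i + j)) < r / 2"
      using eventually_happens by force
    have "\<forall>\<^sub>F k in sequentially. p (comp_from_to T i k (x i) - c i) < r / 2"
      by (rule order_tendstoD(2)[OF lim]) (use \<open>0 < r\<close> in simp)
    with eventually_ge_at_top[of i] show "\<forall>\<^sub>F k in sequentially. p (x (Suc k) - l) < r"
    proof eventually_elim
      case (elim k)
      have "p (x (Suc k) - l) \<le> p (comp_from_to T i k (x i) - c i) + 2 * K * (\<Sum>j. e (i + j))"
        using assms(1-8) elim(1) by (rule gauge_estimate)
      with elim(2) i show ?case by simp
    qed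
  qed
  then show ?thesis by (rule LIMSEQ_imp_Suc)
qed

theorem theorem11:
  fixes T :: "nat \<Rightarrow> 'a \<Rightarrow> 'a :: {real_inner, complete_space}"
    and C :: "'a set"
    and e :: "nat \<Rightarrow> real"
    and x :: "nat \<Rightarrow> 'a"
    and xlim :: "nat \<Rightarrow> 'a"
  assumes "\<And>k. nonexpansive (T k)"
    and "C \<subseteq> (\<Inter>k. Fix (T k))"
    and "C \<noteq> {}" and "closed C" and "convex C"
    and "\<And>k. 0 \<le> e k" and "summable e"
    and "\<And>k. norm (x (Suc k) - T k (x k)) \<le> e k"
    and "\<And>i. xlim i \<in> C"
    and "\<And>i. weakly_tendsto (\<lambda>k. comp_from_to T i k (x i)) (xlim i) sequentially"
  shows "\<exists>xinf \<in> C.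
    xlim \<longlonglongrightarrow> xinf \<and>
    weakly_tendsto x xinf sequentially \<and>
    (\<forall>y i k. i \<le> k \<longrightarrow>
      \<bar>y \<bullet> (x (Suc k) - xinf)\<bar>
        \<le> \<bar>y \<bullet> (comp_from_to T i k (x i) - xlim i)\<bar> + 2 * norm y * (\<Sum>j. e (i + j))) \<and>
    ((\<forall>i. (\<lambda>k. comp_from_to T i k (x i)) \<longlonglongrightarrow> xlim i) \<longrightarrow>
      x \<longlonglongrightarrow> xinf \<and>
      (\<forall>i k. i \<le> k \<longrightarrow>
        norm (x (Suc k) - xinf)
          \<le> norm (comp_from_to T i k (x i) - xlim i) + 2 * (\<Sum>j. e (i + j))))"
proof -
  note data = assms(1,6,7,8)
  obtain xinf where xinf: "xlim \<longlonglongrightarrow> xinf"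
    and rate: "\<And>i. norm (xlim i - xinf) \<le> (\<Sum>j. e (i + j))"
    using weak_limits_converge[OF data assms(10)] by blast
  have "xinf \<in> C"
    using assms(4,9) xinf by (rule closed_sequentially)
  moreover have "weakly_tendsto x xinf sequentially"
    unfolding weakly_tendsto_def
  proof (intro allI impI)
    fix f :: "'a \<Rightarrow> real"
    assume f: "bounded_linear f"
    have "(\<lambda>k. \<bar>f (x k - xinf)\<bar>) \<longlonglongrightarrow> 0"
    proof (rule gauge_tendsto_0[where p = "\<lambda>v. \<bar>f v\<bar>", OF data rate])
      show "\<bar>f (u + v)\<bar> \<le> \<bar>f u\<bar> + \<bar>f v\<bar>" for u v
        using f by (simp add: bounded_linear.linear linear_add abs_triangle_ineq)
      show "0 \<le> onorm f" using f by (rule onorm_pos_le)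
      show "\<bar>f v\<bar> \<le> onorm f * norm v" for v using onorm[OF f, of v] by simp
      show "(\<lambda>k. \<bar>f (comp_from_to T i k (x i) - xlim i)\<bar>) \<longlonglongrightarrow> 0" for i
      proof -
        have "(\<lambda>k. f (comp_from_to T i k (x i))) \<longlonglongrightarrow> f (xlim i)"
          using assms(10)[of i] f unfolding weakly_tendsto_def by blast
        then show ?thesis
          using f by (simp add: LIM_zero tendsto_rabs_zero bounded_linear.linear linear_diff)
      qed
    qed simp
    then have "(\<lambda>k. f (x k) - f xinf) \<longlonglongrightarrow> 0"
      using f by (simp add: tendsto_rabs_zero_iff bounded_linear.linear linear_diff)
    then show "(\<lambda>k. f (x k)) \<longlonglongrightarrow> f xinf" by (rule LIM_zero_cancel)
  qed
  moreover have "\<bar>y \<bullet> (x (Suc k) - xinf)\<bar>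
      \<le> \<bar>y \<bullet> (comp_from_to T i k (x i) - xlim i)\<bar> + 2 * norm y * (\<Sum>j. e (i + j))"
    if "i \<le> k" for y i k
  proof (rule gauge_estimate[where p = "\<lambda>v. \<bar>y \<bullet> v\<bar>", OF data rate _ _ _ that])
    show "\<bar>y \<bullet> (u + v)\<bar> \<le> \<bar>y \<bullet> u\<bar> + \<bar>y \<bullet> v\<bar>" for u v
      by (simp add: inner_add_right abs_triangle_ineq)
    show "\<bar>y \<bullet> v\<bar> \<le> norm y * norm v" for v by (rule Cauchy_Schwarz_ineq2)
  qed simp
  moreover have "x \<longlonglongrightarrow> xinf"
    if strong: "\<And>i. (\<lambda>k. comp_from_to T i k (x i)) \<longlonglongrightarrow> xlim i"
  proof -
    have "(\<lambda>k. norm (x k - xinf)) \<longlonglongrightarrow> 0"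
    proof (rule gauge_tendsto_0[where p = norm and K = 1, OF data rate])
      show "(\<lambda>k. norm (comp_from_to T i k (x i) - xlim i)) \<longlonglongrightarrow> 0" for i
        using strong[of i] by (simp add: LIM_zero tendsto_norm_zero)
    qed (simp_all add: norm_triangle_ineq)
    then show ?thesis
      by (rule LIM_zero_cancel[OF tendsto_norm_zero_cancel])
  qed
  moreover have "norm (x (Suc k) - xinf)
      \<le> norm (comp_from_to T i k (x i) - xlim i) + 2 * (\<Sum>j. e (i + j))"
    if "i \<le> k" for i k
    using gauge_estimate[where p = norm and K = 1, OF data rate norm_triangle_ineq _ _ that]
    by simp
  ultimately show ?thesis
    using xinf by (intro bexI[of _ xinf] conjI allI impI) simp_all
qed

end
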